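(* Let $\mathcal{X}\subset\mathbb{R}^n$ be either an open subset or a smooth submanifold of $\mathbb{R}^n$, let $f$ be a locally Lipschitz vector field on $\mathcal{X}$, and consider the dynamical system $\Sigma:\ \dot x=f(x)$, $x\in\mathcal{X}$, with solutions $\phi(t,x_0)$. Let $\Gamma\subset\mathcal{O}\subset\mathcal{X}$ be two closed sets which are positively invariant for $\Sigma$. (A) The set $\Gamma$ is attractive (i.e., an attractor) for $\Sigma$ if the following conditions hold: (i) $\Gamma$ is asymptotically stable relative to $\mathcal{O}$; (ii) $\mathcal{O}$ is locally attractive near $\Gamma$; (iii) there exists a neighbourhood $\mathcal{N}(\Gamma)$ such that, for all initial conditions in $\mathcal{N}(\Gamma)$, the associated solutions are bounded and such that the set $\mathrm{cl}(\phi(\mathbb{R}^+,\mathcal{N}(\Gamma)))\cap\mathcal{O}$ is contained in the domain of attraction of $\Gamma$ relative to $\mathcal{O}$. (B) The set $\Gamma$ is globally attractive (i.e., a global attractor) for $\Sigma$ if the following conditions hold: (i') $\Gamma$ is globally asymptotically stable relative to $\mathcal{O}$; (ii') $\mathcal{O}$ is a global attractor; (iii') all trajectories of $\Sigma$ in $\mathcal{X}$ are bounded.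
   Context: Notation: $\mathbb{R}^+=[0,+\infty)$; $\phi(t,x_0)$ is the unique solution of $\dot x=f(x)$ with $\phi(0,x_0)=x_0$; for $I\subset\mathbb{R}$ and $S\subset\mathcal{X}$, $\phi(I,S)=\{\phi(t,x_0):t\in I,x_0\in S\}$. For a nonempty closed set $S$, $\|x\|_S=\inf\{\|x-y\|:y\in S\}$, and $B_\alpha(S)=\{y\in\mathcal{X}:\|y\|_S<\alpha\}$. $\mathcal{N}(S)$ denotes an open subset of $\mathcal{X}$ containing $S$ (a neighbourhood of $S$); $\mathrm{cl}(S)$ is the closure of $S$. "Bounded" for solutions/trajectories refers to $t\ge 0$. Statements involving $t\to\infty$ or $\phi(\mathbb{R}^+,\cdot)$ presuppose that the solutions concerned are defined for all $t\ge0$. A set $S$ is positively invariant if $\phi(t,x_0)\in S$ for all $x_0\in S$ and all $t\ge0$. Let $\Gamma\subset\mathcal{X}$ be closed and positively invariant. - $\Gamma$ is stable if for all $\varepsilon>0$ there is a neighbourhood $\mathcal{N}(\Gamma)$ with $\phi(\mathbb{R}^+,\mathcal{N}(\Gamma))\subset B_\varepsilon(\Gamma)$. - $\Gamma$ is an attractor (attractive) if there is a neighbourhood $\mathcal{N}(\Gamma)$ such that $\lim_{t\to\infty}\|\phi(t,x_0)\|_\Gamma=0$ for all $x_0\in\mathcal{N}(\Gamma)$; it is a global attractor (globally attractive) if this holds with $\mathcal{N}(\Gamma)=\mathcal{X}$. - $\Gamma$ is [globally] asymptotically stable if it is stable and [globally] attractive. Relative notions: for $\mathcal{O}\subset\mathcal{X}$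 with $\mathcal{O}\cap\Gamma\ne\emptyset$, $\Gamma$ is stable relative to $\mathcal{O}$ if for every $\varepsilon>0$ there is $\mathcal{N}(\Gamma)$ with $\phi(\mathbb{R}^+,\mathcal{N}(\Gamma)\cap\mathcal{O})\subset B_\varepsilon(\Gamma)$. Relative [global] attractivity and relative [global] asymptotic stability are obtained from the definitions above in the same way, by restricting initial conditions to lie in $\mathcal{O}$. The domain of attraction of $\Gamma$ relative to $\mathcal{O}$ is the set of $x_0\in\mathcal{O}$ with $\lim_{t\to\infty}\|\phi(t,x_0)\|_\Gamma=0$. For positively invariant sets $\Gamma\subset\mathcal{O}\subset\mathcal{X}$, $\mathcal{O}$ is locally attractive near $\Gamma$ if there is a neighbourhood $\mathcal{N}(\Gamma)$ such that, for all $x_0\in\mathcal{N}(\Gamma)$, $\phi(t,x_0)\to\mathcal{O}$ (i.e., $\|\phi(t,x_0)\|_{\mathcal{O}}\to0$) as $t\to+\infty$. *)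

theory Defs
  imports "HOL-Analysis.Analysis"
begin

section \<open>Smooth submanifolds of Euclidean space\<close>

text \<open>On an open set \<open>U\<close>, \<open>Ck_on k f U\<close> says that all iterated directional derivatives of
  \<open>f\<close> up to order \<open>k\<close> exist (as Frechet derivatives) and are continuous.\<close>

fun Ck_on :: "nat \<Rightarrow> ('a::euclidean_space \<Rightarrow> 'b::euclidean_space) \<Rightarrow> 'a set \<Rightarrow> bool" where
  "Ck_on 0 f U \<longleftrightarrow> continuous_on U f"
| "Ck_on (Suc k) f U \<longleftrightarrow>
     (\<forall>x\<in>U. f differentiable (at x)) \<and>
     (\<forall>v. Ck_on k (\<lambda>x. frechet_derivative f (at x) v) U)"

definition smooth_on :: "'a set \<Rightarrow> ('a::euclidean_space \<Rightarrow> 'b::euclidean_space) \<Rightarrow> bool" where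
  "smooth_on U f \<longleftrightarrow> (\<forall>k. Ck_on k f U)"

text \<open>Embedded submanifolds: near each point, a diffeomorphism between open sets of the ambient
  space straightens the set to a linear subspace \<open>S\<close>, whose dimension is the dimension of the
  submanifold.\<close>

definition smooth_submanifold :: "'a::euclidean_space set \<Rightarrow> bool" where
  "smooth_submanifold \<X> \<longleftrightarrow>
     (\<exists>S :: 'a set. subspace S \<and>
       (\<forall>p\<in>\<X>. \<exists>U V (\<psi> :: 'a \<Rightarrow> 'a) \<psi>'. open U \<and> p \<in> U \<and> open V \<and> homeomorphism U V \<psi> \<psi>' \<and>
          smooth_on U \<psi> \<and> smooth_on V \<psi>' \<and> \<psi> ` (U \<inter> \<X>) = V \<inter> S))"

text \<open>Velocities at \<open>p\<close> of smooth curves in \<open>\<X>\<close>.\<close>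

definition tangent_space :: "'a::euclidean_space set \<Rightarrow> 'a \<Rightarrow> 'a set" where
  "tangent_space \<X> p =
     {v. \<exists>c e. 0 < e \<and> smooth_on {-e<..<e} c \<and> c ` {-e<..<e} \<subseteq> \<X> \<and>
           c (0::real) = p \<and> (c has_vector_derivative v) (at 0)}"

section \<open>Solutions\<close>

text \<open>Throughout, only the values of \<open>f\<close> on \<open>\<X>\<close> matter.\<close>

definition solution_on ::
  "('a::euclidean_space \<Rightarrow> 'a) \<Rightarrow> 'a set \<Rightarrow> real set \<Rightarrow> 'a \<Rightarrow> (real \<Rightarrow> 'a) \<Rightarrow> bool" where
  "solution_on f \<X> I x0 x \<longleftrightarrow>
     x 0 = x0 \<and> (\<forall>t\<in>I. x t \<in> \<X> \<and> (x has_vector_derivative f (x t)) (at t within I))"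

text \<open>The value at time \<open>t\<close> of the solution starting at \<open>x0\<close>. It is meaningful when
  that solution exists on the whole interval between 0 and \<open>t\<close>.\<close>

definition flow :: "('a::euclidean_space \<Rightarrow> 'a) \<Rightarrow> 'a set \<Rightarrow> real \<Rightarrow> 'a \<Rightarrow> 'a" where
  "flow f \<X> t x0 = (THE y. \<exists>x. solution_on f \<X> (closed_segment 0 t) x0 x \<and> x t = y)"

text \<open>The notions below involving all \<open>t \<ge> 0\<close> include the requirement that the
  solutions concerned are defined for all \<open>t \<ge> 0\<close>.\<close>

definition forward_complete :: "('a::euclidean_space \<Rightarrow> 'a) \<Rightarrow> 'a set \<Rightarrow> 'a \<Rightarrow> bool" where
  "forward_complete f \<X> x0 \<longleftrightarrow> (\<exists>x. solution_on f \<X> {0..} x0 x)"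

definition flow_image ::
  "('a::euclidean_space \<Rightarrow> 'a) \<Rightarrow> 'a set \<Rightarrow> real set \<Rightarrow> 'a set \<Rightarrow> 'a set" where
  "flow_image f \<X> I S = {flow f \<X> t x0 | t x0. t \<in> I \<and> x0 \<in> S}"

definition bounded_solution :: "('a::euclidean_space \<Rightarrow> 'a) \<Rightarrow> 'a set \<Rightarrow> 'a \<Rightarrow> bool" where
  "bounded_solution f \<X> x0 \<longleftrightarrow>
     forward_complete f \<X> x0 \<and> bounded (flow_image f \<X> {0..} {x0})"

definition tends_to_set ::
  "('a::euclidean_space \<Rightarrow> 'a) \<Rightarrow> 'a set \<Rightarrow> 'a \<Rightarrow> 'a set \<Rightarrow> bool" where
  "tends_to_set f \<X> x0 S \<longleftrightarrow>
     forward_complete f \<X> x0 \<and> ((\<lambda>t. infdist (flow f \<X> t x0) S) \<longlongrightarrow> 0) at_top"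

definition positively_invariant :: "('a::euclidean_space \<Rightarrow> 'a) \<Rightarrow> 'a set \<Rightarrow> 'a set \<Rightarrow> bool" where
  "positively_invariant f \<X> S \<longleftrightarrow>
     (\<forall>x0\<in>S. forward_complete f \<X> x0 \<and> (\<forall>t\<ge>0. flow f \<X> t x0 \<in> S))"

section \<open>Stability and attractivity of sets\<close>

definition nbhd :: "'a::euclidean_space set \<Rightarrow> 'a set \<Rightarrow> 'a set \<Rightarrow> bool" where
  "nbhd \<X> S N \<longleftrightarrow> openin (top_of_set \<X>) N \<and> S \<subseteq> N"

definition set_ball :: "'a::euclidean_space set \<Rightarrow> real \<Rightarrow> 'a set \<Rightarrow> 'a set" where
  "set_ball \<X> \<alpha> S = {y\<in>\<X>. infdist y S < \<alpha>}"

definition attractor :: "('a::euclidean_space \<Rightarrow> 'a) \<Rightarrow> 'a set \<Rightarrow> 'a set \<Rightarrow> bool" where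
  "attractor f \<X> \<Gamma> \<longleftrightarrow> (\<exists>N. nbhd \<X> \<Gamma> N \<and> (\<forall>x0\<in>N. tends_to_set f \<X> x0 \<Gamma>))"

definition global_attractor :: "('a::euclidean_space \<Rightarrow> 'a) \<Rightarrow> 'a set \<Rightarrow> 'a set \<Rightarrow> bool" where
  "global_attractor f \<X> \<Gamma> \<longleftrightarrow> (\<forall>x0\<in>\<X>. tends_to_set f \<X> x0 \<Gamma>)"

definition stable_rel :: "('a::euclidean_space \<Rightarrow> 'a) \<Rightarrow> 'a set \<Rightarrow> 'a set \<Rightarrow> 'a set \<Rightarrow> bool" where
  "stable_rel f \<X> \<O> \<Gamma> \<longleftrightarrow>
     (\<forall>\<epsilon>>0. \<exists>N. nbhd \<X> \<Gamma> N \<and> (\<forall>x0\<in>N \<inter> \<O>. forward_complete f \<X> x0) \<and>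
        flow_image f \<X> {0..} (N \<inter> \<O>) \<subseteq> set_ball \<X> \<epsilon> \<Gamma>)"

definition attractor_rel :: "('a::euclidean_space \<Rightarrow> 'a) \<Rightarrow> 'a set \<Rightarrow> 'a set \<Rightarrow> 'a set \<Rightarrow> bool" where
  "attractor_rel f \<X> \<O> \<Gamma> \<longleftrightarrow> (\<exists>N. nbhd \<X> \<Gamma> N \<and> (\<forall>x0\<in>N \<inter> \<O>. tends_to_set f \<X> x0 \<Gamma>))"

definition global_attractor_rel ::
  "('a::euclidean_space \<Rightarrow> 'a) \<Rightarrow> 'a set \<Rightarrow> 'a set \<Rightarrow> 'a set \<Rightarrow> bool" where
  "global_attractor_rel f \<X> \<O> \<Gamma> \<longleftrightarrow> (\<forall>x0\<in>\<O>. tends_to_set f \<X> x0 \<Gamma>)"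

definition asymptotically_stable_rel ::
  "('a::euclidean_space \<Rightarrow> 'a) \<Rightarrow> 'a set \<Rightarrow> 'a set \<Rightarrow> 'a set \<Rightarrow> bool" where
  "asymptotically_stable_rel f \<X> \<O> \<Gamma> \<longleftrightarrow> stable_rel f \<X> \<O> \<Gamma> \<and> attractor_rel f \<X> \<O> \<Gamma>"

definition globally_asymptotically_stable_rel ::
  "('a::euclidean_space \<Rightarrow> 'a) \<Rightarrow> 'a set \<Rightarrow> 'a set \<Rightarrow> 'a set \<Rightarrow> bool" where
  "globally_asymptotically_stable_rel f \<X> \<O> \<Gamma> \<longleftrightarrow>
     stable_rel f \<X> \<O> \<Gamma> \<and> global_attractor_rel f \<X> \<O> \<Gamma>"

definition domain_of_attraction_rel ::
  "('a::euclidean_space \<Rightarrow> 'a) \<Rightarrow> 'a set \<Rightarrow> 'a set \<Rightarrow> 'a set \<Rightarrow> 'a set" where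
  "domain_of_attraction_rel f \<X> \<O> \<Gamma> = {x0\<in>\<O>. tends_to_set f \<X> x0 \<Gamma>}"

definition locally_attractive_near ::
  "('a::euclidean_space \<Rightarrow> 'a) \<Rightarrow> 'a set \<Rightarrow> 'a set \<Rightarrow> 'a set \<Rightarrow> bool" where
  "locally_attractive_near f \<X> \<O> \<Gamma> \<longleftrightarrow>
     (\<exists>N. nbhd \<X> \<Gamma> N \<and> (\<forall>x0\<in>N. tends_to_set f \<X> x0 \<O>))"

end

theory Submission
  imports Defs
begin

text \<open>
  Let \<open>L\<close> be the omega-limit set of a bounded solution that tends to \<open>\<O>\<close>. It is compact,
  contained in \<open>\<O>\<close>, and the flow maps it onto itself. Given \<open>p \<in> L\<close>, pick \<open>q\<^sub>n \<in> L\<close> with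
  \<open>\<phi>(n, q\<^sub>n) = p\<close> and, passing to a subsequence, \<open>q\<^sub>n \<rightarrow> q \<in> L\<close>. Since \<open>q\<close> is attracted to \<open>\<Gamma>\<close>,
  its solution is at some time \<open>T\<close> in the neighbourhood of \<open>\<Gamma>\<close> provided by relative stability
  for \<open>\<epsilon>\<close>. By continuous dependence so is \<open>\<phi>(T, q\<^sub>n)\<close> for some \<open>n \<ge> T\<close>, whence
  \<open>p = \<phi>(n - T, \<phi>(T, q\<^sub>n))\<close> is within \<open>\<epsilon>\<close> of \<open>\<Gamma>\<close>. Thus \<open>L \<subseteq> \<Gamma>\<close>.
\<close>

section \<open>Uniqueness and continuous dependence of solutions\<close>

text \<open>A sequence violating the bound with constants n and radii 1/(n+1) would accumulate at a
  point of \<open>K\<close>, where the local Lipschitz constant contradicts it. Only one of the two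
  points is confined to \<open>K\<close>, so a perturbed solution may leave the reference
  orbit.\<close>

lemma local_lipschitz_near_compact:
  fixes f :: "'a::euclidean_space \<Rightarrow> 'a"
  assumes lip: "local_lipschitz UNIV X (\<lambda>_::real. f)" and "compact K" "K \<subseteq> X"
  obtains \<delta> L where "0 < \<delta>" "0 \<le> L"
    "\<And>y z. y \<in> K \<Longrightarrow> z \<in> X \<Longrightarrow> dist y z < \<delta> \<Longrightarrow> dist (f y) (f z) \<le> L * dist y z"
proof -
  have "\<exists>n::nat. \<forall>y\<in>K. \<forall>z\<in>X. dist y z < inverse (real (Suc n)) \<longrightarrow> dist (f y) (f z) \<le> real n * dist y z"
  proof (rule ccontr)
    assume "\<not> ?thesis"
    then have "\<forall>n::nat. \<exists>y z. y \<in> K \<and> z \<in> X \<and> dist y z < inverse (real (Suc n)) \<and>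
        real n * dist y z < dist (f y) (f z)"
      by (simp add: not_le Bex_def)
    then obtain y z where y: "\<And>n::nat. y n \<in> K" and z: "\<And>n. z n \<in> X"
      and close: "\<And>n. dist (y n) (z n) < inverse (real (Suc n))"
      and big: "\<And>n. real n * dist (y n) (z n) < dist (f (y n)) (f (z n))"
      by metis
    obtain l r where l: "l \<in> K" "strict_mono r" and "(y \<circ> r) \<longlonglongrightarrow> l"
      using \<open>compact K\<close> y by (meson compact_def)
    then have yl: "(\<lambda>n. y (r n)) \<longlonglongrightarrow> l" by (simp add: o_def)
    have "l \<in> X" using l(1) \<open>K \<subseteq> X\<close> by blast
    then obtain u L where "u > 0"
      and "\<And>t. t \<in> cball (0::real) u \<inter> UNIV \<Longrightarrow> L-lipschitz_on (cball l u \<inter> X) f"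
      using local_lipschitzE[OF lip UNIV_I[of 0]] by metis
    from this(2)[of 0] \<open>u > 0\<close> have L: "L-lipschitz_on (cball l u \<inter> X) f" by simp
    have "(\<lambda>n. dist (y n) (z n)) \<longlonglongrightarrow> 0"
      by (rule tendsto_sandwich[OF _ _ tendsto_const LIMSEQ_inverse_real_of_nat])
        (use close in \<open>auto intro!: always_eventually less_imp_le\<close>)
    then have "(\<lambda>n. dist (y (r n)) (z (r n))) \<longlonglongrightarrow> 0"
      using LIMSEQ_subseq_LIMSEQ[OF _ l(2), of "\<lambda>n. dist (y n) (z n)"] by (simp add: o_def)
    \<comment> \<open>By the triangle inequality the sum bounds the distance of both
      \<open>y (r n)\<close> and \<open>z (r n)\<close> from \<open>l\<close>, so one eventuality
      puts both in the ball.\<close>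
    then have "(\<lambda>n. dist (y (r n)) l + dist (y (r n)) (z (r n))) \<longlonglongrightarrow> 0"
      using tendsto_add[OF tendsto_dist[OF yl tendsto_const[of l]]] by force
    then have "eventually (\<lambda>n. dist (y (r n)) l + dist (y (r n)) (z (r n)) < u) sequentially"
      using \<open>u > 0\<close> by (rule order_tendstoD)
    moreover have "eventually (\<lambda>n. L \<le> real n) sequentially"
      using filterlim_real_sequentially by (simp add: filterlim_at_top)
    ultimately have "eventually (\<lambda>n. False) sequentially"
    proof eventually_elim
      case (elim n)
      have "y (r n) \<in> cball l u" unfolding mem_cball
        using elim(1) zero_le_dist[of "y (r n)" "z (r n)"] dist_commute[of l "y (r n)"] by linarith
      moreover have "z (r n) \<in> cball l u" unfolding mem_cball
        using elim(1) dist_triangle[of l "z (r n)" "y (r n)"] dist_commute[of l "y (r n)"] by linarith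
      ultimately have "dist (f (y (r n))) (f (z (r n))) \<le> L * dist (y (r n)) (z (r n))"
        using y z \<open>K \<subseteq> X\<close> by (intro lipschitz_onD[OF L]) auto
      \<comment> \<open>Here \<open>L \<le> n \<le> r n\<close>, because a strictly increasing
        sequence of naturals dominates its index.\<close>
      also have "\<dots> \<le> real (r n) * dist (y (r n)) (z (r n))"
        using elim(2) seq_suble[OF l(2), of n] by (intro mult_right_mono) auto
      finally show False using big[of "r n"] by simp
    qed
    then show False by simp
  qed
  then obtain n :: nat where "\<forall>y\<in>K. \<forall>z\<in>X. dist y z < inverse (real (Suc n)) \<longrightarrow>
      dist (f y) (f z) \<le> real n * dist y z" by blast
  then show thesis
    by (intro that[of "inverse (real (Suc n))" "real n"]) auto
qed

text \<open>By Cauchy-Schwarz, \<open>exp (- 2 * L * t)\<close> times the squared norm has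
  nonpositive derivative; squaring avoids the kink of the norm at 0. The mean value theorem uses
  \<open>b\<close> at an interior time, hence the open interval, which later allows the bound to be
  applied at a first exit time.\<close>

lemma norm_gronwall:
  fixes w w' :: "real \<Rightarrow> 'a::real_inner"
  assumes w: "\<And>t. t \<in> {0..T} \<Longrightarrow> (w has_vector_derivative w' t) (at t within {0..T})"
    and b: "\<And>t. t \<in> {0<..<T} \<Longrightarrow> norm (w' t) \<le> L * norm (w t)"
    and "0 \<le> T"
  shows "norm (w T) \<le> exp (L * T) * norm (w 0)"
proof (cases "T = 0")
  case False
  then have "0 < T" using \<open>0 \<le> T\<close> by simp
  define g where "g = (\<lambda>t. exp (- 2 * L * t) * (w t \<bullet> w t))"
  have g: "(g has_derivative (\<lambda>h. h * (exp (- 2 * L * t) * (2 * (w t \<bullet> w' t) - 2 * L * (w t \<bullet> w t)))))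
      (at t within {0..T})" if "0 \<le> t" "t \<le> T" for t
    unfolding g_def using w[of t] that
    by (auto intro!: derivative_eq_intros simp: has_vector_derivative_def algebra_simps inner_commute)
  obtain t where t: "t \<in> {0<..<T}"
    and gt: "g T - g 0 = (T - 0) * (exp (- 2 * L * t) * (2 * (w t \<bullet> w' t) - 2 * L * (w t \<bullet> w t)))"
    using mvt_simple[OF \<open>0 < T\<close> g] by auto
  have "w t \<bullet> w' t \<le> norm (w t) * norm (w' t)" by (rule norm_cauchy_schwarz)
  also have "\<dots> \<le> norm (w t) * (L * norm (w t))" using b[OF t] by (intro mult_left_mono) auto
  also have "\<dots> = L * (w t \<bullet> w t)" by (simp add: dot_square_norm power2_eq_square)
  finally have "g T - g 0 \<le> 0"
    unfolding gt using \<open>0 < T\<close> by (intro mult_nonneg_nonpos) auto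
  then have "exp (- 2 * L * T) * (norm (w T))\<^sup>2 \<le> (norm (w 0))\<^sup>2"
    by (simp add: g_def dot_square_norm)
  then have "exp (2 * L * T) * (exp (- 2 * L * T) * (norm (w T))\<^sup>2) \<le> exp (2 * L * T) * (norm (w 0))\<^sup>2"
    by (intro mult_left_mono) auto
  then have "(norm (w T))\<^sup>2 \<le> (exp (L * T) * norm (w 0))\<^sup>2"
    by (simp add: power_mult_distrib mult.assoc[symmetric] exp_add[symmetric] exp_double[symmetric])
  then show ?thesis by (rule power2_le_imp_le) simp
qed simp

lemma solution_on_subset:
  "solution_on f X I x0 x \<Longrightarrow> J \<subseteq> I \<Longrightarrow> solution_on f X J x0 x"
  unfolding solution_on_def by (meson has_vector_derivative_within_subset subsetD)

text \<open>Gronwall's inequality for the difference of two solutions, with a Lipschitz constant of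
  \<open>f\<close> around the compact arc traced by \<open>x\<close>. The perturbed solution is
  assumed to exist up to \<open>T\<close>; its existence is not claimed.\<close>

lemma solution_on_dependence:
  fixes f :: "'a::euclidean_space \<Rightarrow> 'a"
  assumes lip: "local_lipschitz UNIV X (\<lambda>_::real. f)"
    and x: "solution_on f X {0..T} q x"
  obtains \<delta> C where "0 < \<delta>"
    "\<And>q' y t. solution_on f X {0..T} q' y \<Longrightarrow> dist q' q < \<delta> \<Longrightarrow> t \<in> {0..T} \<Longrightarrow>
      dist (y t) (x t) \<le> C * dist q' q"
proof -
  have cx: "continuous_on {0..T} x"
    using x unfolding solution_on_def
    by (meson continuous_on_eq_continuous_within has_vector_derivative_continuous)
  have "compact (x ` {0..T})" using cx by (intro compact_continuous_image) auto
  moreover have "x ` {0..T} \<subseteq> X" using x by (auto simp: solution_on_def)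
  ultimately obtain d L where "0 < d" "0 \<le> L"
    and L: "\<And>y z. y \<in> x ` {0..T} \<Longrightarrow> z \<in> X \<Longrightarrow> dist y z < d \<Longrightarrow> dist (f y) (f z) \<le> L * dist y z"
    using local_lipschitz_near_compact[OF lip] by metis
  show thesis
  \<comment> \<open>This radius keeps the Gronwall bound \<open>exp (L * T) * dist q' q\<close>
    below \<open>d\<close>, within the range where the Lipschitz estimate is valid.\<close>
  proof (rule that[of "d / exp (L * T)" "exp (L * T)"])
    fix q' y t
    assume y: "solution_on f X {0..T} q' y" and q': "dist q' q < d / exp (L * T)"
      and t: "t \<in> {0..T}"
    define w where "w = (\<lambda>t. y t - x t)"
    have w: "(w has_vector_derivative (f (y t) - f (x t))) (at t within {0..T})" if "t \<in> {0..T}" for t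
      unfolding w_def using x y that by (intro has_vector_derivative_diff) (auto simp: solution_on_def)
    have w0: "norm (w 0) = dist q' q" using x y by (simp add: w_def dist_norm solution_on_def)
    \<comment> \<open>Smallness is required strictly before \<open>s\<close>, so that the estimate
      applies at the first exit time \<open>Inf B\<close> itself.\<close>
    have est: "norm (w s) \<le> exp (L * T) * dist q' q"
      if s: "s \<in> {0..T}" and small: "\<And>r. r \<in> {0<..<s} \<Longrightarrow> norm (w r) < d" for s
    proof -
      have "norm (w s) \<le> exp (L * s) * norm (w 0)"
      proof (rule norm_gronwall)
        show "(w has_vector_derivative (f (y r) - f (x r))) (at r within {0..s})" if "r \<in> {0..s}" for r
          using w[of r] that s by (auto intro: has_vector_derivative_within_subset)
        show "norm (f (y r) - f (x r)) \<le> L * norm (w r)" if r: "r \<in> {0<..<s}" for r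
        proof -
          have "x r \<in> x ` {0..T}" "y r \<in> X" using r s y by (auto simp: solution_on_def)
          then show ?thesis
            using L[of "x r" "y r"] small[OF r] by (simp add: w_def dist_norm norm_minus_commute)
        qed
      qed (use s in auto)
      also have "\<dots> \<le> exp (L * T) * norm (w 0)"
        using s \<open>0 \<le> L\<close> by (intro mult_right_mono) (auto intro: mult_left_mono)
      finally show ?thesis by (simp add: w0)
    qed
    have lt: "exp (L * T) * dist q' q < d" using q' by (simp add: field_simps)
    \<comment> \<open>The estimate only holds while \<open>w\<close> is small; consider the first time at which it is not.\<close>
    have small: "norm (w r) < d" if "r \<in> {0..T}" for r
    proof (rule ccontr)
      assume r: "\<not> norm (w r) < d"
      define B where "B = {s \<in> {0..T}. d \<le> norm (w s)}"
      have cw: "continuous_on {0..T} w"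
        using w by (meson continuous_on_eq_continuous_within has_vector_derivative_continuous)
      have "closed B" unfolding B_def
        by (intro continuous_on_closed_Collect_le continuous_intros cw)
      moreover have "B \<noteq> {}" "bdd_below B" using r that by (auto simp: B_def)
      ultimately have m: "Inf B \<in> B" by (intro closed_contains_Inf)
      have "norm (w s) < d" if "s \<in> {0<..<Inf B}" for s
      proof (rule ccontr)
        assume "\<not> norm (w s) < d"
        then have "s \<in> B" using that m by (auto simp: B_def)
        then have "Inf B \<le> s" using \<open>bdd_below B\<close> by (rule cInf_lower)
        then show False using that by simp
      qed
      then have "norm (w (Inf B)) < d" using est[of "Inf B"] m lt by (force simp: B_def)
      then show False using m by (simp add: B_def)
    qed
    show "dist (y t) (x t) \<le> exp (L * T) * dist q' q"
      using est[OF t] small t by (fastforce simp: w_def dist_norm)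
  qed (use \<open>0 < d\<close> in auto)
qed

text \<open>With \<open>q' = q\<close> the dependence estimate has right-hand side 0.\<close>

lemma solution_on_unique:
  fixes f :: "'a::euclidean_space \<Rightarrow> 'a"
  assumes "local_lipschitz UNIV X (\<lambda>_::real. f)"
    and "solution_on f X {0..T} q x" "solution_on f X {0..T} q y" "t \<in> {0..T}"
  shows "y t = x t"
proof -
  obtain \<delta> C where "0 < \<delta>" "\<And>q' y t. solution_on f X {0..T} q' y \<Longrightarrow> dist q' q < \<delta> \<Longrightarrow> t \<in> {0..T} \<Longrightarrow>
      dist (y t) (x t) \<le> C * dist q' q"
    using solution_on_dependence[OF assms(1,2)] by metis
  from this(2)[OF assms(3) _ assms(4)] this(1) show ?thesis by simp
qed

section \<open>The flow: semigroup law and continuity\<close>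

text \<open>Uniqueness makes the definite description in \<open>flow\<close> well defined, so that
  \<open>flow\<close> can be handled as a genuine solution.\<close>

lemma flow_eq_solution:
  fixes f :: "'a::euclidean_space \<Rightarrow> 'a"
  assumes lip: "local_lipschitz UNIV X (\<lambda>_::real. f)"
    and x: "solution_on f X {0..} q x" and "0 \<le> t"
  shows "flow f X t q = x t"
proof -
  have I: "closed_segment 0 t = {0..t}" using \<open>0 \<le> t\<close> by (simp add: closed_segment_eq_real_ivl)
  have x': "solution_on f X {0..t} q x" using x by (rule solution_on_subset) auto
  show ?thesis unfolding flow_def I
  proof (rule the_equality)
    show "y = x t" if "\<exists>z. solution_on f X {0..t} q z \<and> z t = y" for y
      using that solution_on_unique[OF lip x'] \<open>0 \<le> t\<close> by (metis atLeastAtMost_iff order_refl)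
  qed (use x' in blast)
qed

lemma solution_on_flow:
  fixes f :: "'a::euclidean_space \<Rightarrow> 'a"
  assumes lip: "local_lipschitz UNIV X (\<lambda>_::real. f)"
    and "forward_complete f X q"
  shows "solution_on f X {0..} q (\<lambda>t. flow f X t q)"
proof -
  obtain x where x: "solution_on f X {0..} q x" using assms(2) by (auto simp: forward_complete_def)
  have eq: "\<And>t. 0 \<le> t \<Longrightarrow> flow f X t q = x t" using flow_eq_solution[OF lip x] .
  show ?thesis unfolding solution_on_def
  proof (intro conjI ballI)
    fix t :: real assume t: "t \<in> {0..}"
    then have "(x has_vector_derivative f (flow f X t q)) (at t within {0..})"
      using x by (simp add: eq solution_on_def)
    then show "((\<lambda>t. flow f X t q) has_vector_derivative f (flow f X t q)) (at t within {0..})"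
      using t by (rule has_vector_derivative_transform[rotated 2]) (simp add: eq)
  qed (use x eq in \<open>auto simp: solution_on_def\<close>)
qed

text \<open>As \<open>f\<close> does not depend on time, translating a solution in time gives a
  solution; the semigroup law \<open>flow_flow\<close> then follows by uniqueness.\<close>

lemma flow_shift_solution:
  fixes f :: "'a::euclidean_space \<Rightarrow> 'a"
  assumes "local_lipschitz UNIV X (\<lambda>_::real. f)"
    and "forward_complete f X q" and "0 \<le> s"
  shows "solution_on f X {0..} (flow f X s q) (\<lambda>t. flow f X (t + s) q)"
proof -
  let ?x = "\<lambda>t. flow f X t q"
  have x: "solution_on f X {0..} q ?x" by (rule solution_on_flow[OF assms(1,2)])
  show ?thesis unfolding solution_on_def
  proof (intro conjI ballI)
    fix t :: real assume t: "t \<in> {0..}"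
    have "(?x has_vector_derivative f (?x (t + s))) (at (t + s) within {0..})"
      using x t \<open>0 \<le> s\<close> by (simp add: solution_on_def)
    \<comment> \<open>The chain rule asks for the derivative within the image of the half-line under
      the shift, which is \<open>{s..}\<close>.\<close>
    then have "(?x has_vector_derivative f (?x (t + s))) (at (t + s) within (\<lambda>t. t + s) ` {0..})"
      by (rule has_vector_derivative_within_subset) (use \<open>0 \<le> s\<close> in auto)
    moreover have "((\<lambda>t. t + s) has_vector_derivative 1) (at t within {0..})"
      by (auto intro!: derivative_eq_intros)
    ultimately show "((\<lambda>t. ?x (t + s)) has_vector_derivative f (?x (t + s))) (at t within {0..})"
      using vector_diff_chain_within[of "\<lambda>t. t + s" 1 t "{0..}" ?x] by (simp add: o_def)
  qed (use x \<open>0 \<le> s\<close> in \<open>auto simp: solution_on_def\<close>)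
qed

lemma forward_complete_flow:
  fixes f :: "'a::euclidean_space \<Rightarrow> 'a"
  assumes "local_lipschitz UNIV X (\<lambda>_::real. f)"
    and "forward_complete f X q" and "0 \<le> s"
  shows "forward_complete f X (flow f X s q)"
  using flow_shift_solution[OF assms] by (auto simp: forward_complete_def)

lemma flow_flow:
  fixes f :: "'a::euclidean_space \<Rightarrow> 'a"
  assumes "local_lipschitz UNIV X (\<lambda>_::real. f)"
    and "forward_complete f X q" and "0 \<le> s" "0 \<le> t"
  shows "flow f X t (flow f X s q) = flow f X (t + s) q"
  using flow_eq_solution[OF assms(1) flow_shift_solution[OF assms(1-3)] assms(4)] .

text \<open>The dependence estimate squeezes the distance to 0 once \<open>p n\<close> is within
  \<open>\<delta>\<close> of \<open>q\<close>. Every \<open>p n\<close> is assumed forward complete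
  because that estimate compares solutions already known to exist.\<close>

lemma flow_tendsto:
  fixes f :: "'a::euclidean_space \<Rightarrow> 'a"
  assumes lip: "local_lipschitz UNIV X (\<lambda>_::real. f)"
    and q: "forward_complete f X q" and p: "\<And>n::nat. forward_complete f X (p n)"
    and lim: "p \<longlonglongrightarrow> q" and "0 \<le> t"
  shows "(\<lambda>n. flow f X t (p n)) \<longlonglongrightarrow> flow f X t q"
proof -
  have sol: "solution_on f X {0..t} y (\<lambda>t. flow f X t y)" if "forward_complete f X y" for y
    using solution_on_flow[OF lip that] by (rule solution_on_subset) auto
  obtain \<delta> C where "0 < \<delta>" and C: "\<And>q' y s. solution_on f X {0..t} q' y \<Longrightarrow> dist q' q < \<delta> \<Longrightarrow>
      s \<in> {0..t} \<Longrightarrow> dist (y s) (flow f X s q) \<le> C * dist q' q"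
    using solution_on_dependence[OF lip sol[OF q]] by metis
  have "(\<lambda>n. dist (p n) q) \<longlonglongrightarrow> 0" using lim by (rule tendsto_dist_iff[THEN iffD1])
  then have C0: "(\<lambda>n. C * dist (p n) q) \<longlonglongrightarrow> 0" by (rule tendsto_mult_right_zero)
  have "eventually (\<lambda>n. dist (p n) q < \<delta>) sequentially"
    using \<open>(\<lambda>n. dist (p n) q) \<longlonglongrightarrow> 0\<close> \<open>0 < \<delta>\<close> by (rule order_tendstoD)
  then have "eventually (\<lambda>n. dist (flow f X t (p n)) (flow f X t q) \<le> C * dist (p n) q) sequentially"
    by eventually_elim (rule C[OF sol[OF p]], use \<open>0 \<le> t\<close> in simp_all)
  then have "(\<lambda>n. dist (flow f X t (p n)) (flow f X t q)) \<longlonglongrightarrow> 0"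
    by (rule tendsto_sandwich[OF always_eventually _ tendsto_const C0, rotated]) simp
  then show ?thesis by (rule tendsto_dist_iff[THEN iffD2])
qed

section \<open>Omega-limit sets\<close>

text \<open>Closures are taken in the ambient space, so a limit point may a priori lie outside
  \<open>X\<close>. Tails start at nonnegative times, where \<open>flow\<close> is meaningful for
  forward complete points.\<close>

definition omega_limit :: "('a::euclidean_space \<Rightarrow> 'a) \<Rightarrow> 'a set \<Rightarrow> 'a \<Rightarrow> 'a set" where
  "omega_limit f X x0 = (\<Inter>s\<in>{0..}. closure ((\<lambda>t. flow f X t x0) ` {s..}))"

text \<open>The offset \<open>a\<close> leaves room to subtract a fixed time from every
  \<open>\<tau> n\<close> and still have times tending to infinity.\<close>

lemma omega_limitE:
  assumes "p \<in> omega_limit f X x0"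
  obtains \<tau> where "\<And>n::nat. a + real n \<le> \<tau> n" "(\<lambda>n. flow f X (\<tau> n) x0) \<longlonglongrightarrow> p"
proof -
  have "\<exists>t. a + real n \<le> t \<and> dist (flow f X t x0) p < inverse (real (Suc n))" for n
  proof -
    \<comment> \<open>The maximum with 0 makes this tail one of those intersected in
      \<open>omega_limit\<close>, whatever the sign of \<open>a\<close>.\<close>
    have "p \<in> closure ((\<lambda>t. flow f X t x0) ` {max 0 (a + real n)..})"
      using assms by (simp add: omega_limit_def)
    then show ?thesis unfolding closure_approachable
      by (metis (no_types, lifting) atLeast_iff imageE inverse_positive_iff_positive
          max.bounded_iff of_nat_0_less_iff zero_less_Suc)
  qed
  then obtain \<tau> where \<tau>: "\<And>n::nat. a + real n \<le> \<tau> n"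
    "\<And>n. dist (flow f X (\<tau> n) x0) p < inverse (real (Suc n))" by metis
  have "(\<lambda>n. dist (flow f X (\<tau> n) x0) p) \<longlonglongrightarrow> 0"
    by (rule tendsto_sandwich[OF _ _ tendsto_const LIMSEQ_inverse_real_of_nat])
      (use \<tau>(2) in \<open>auto intro!: always_eventually less_imp_le\<close>)
  then show thesis by (rule that[OF \<tau>(1) tendsto_dist_iff[THEN iffD2]])
qed

lemma omega_limitI:
  assumes "filterlim \<tau> at_top sequentially" "(\<lambda>n::nat. flow f X (\<tau> n) x0) \<longlonglongrightarrow> p"
  shows "p \<in> omega_limit f X x0"
  unfolding omega_limit_def
proof (rule INT_I)
  fix s :: real
  have "eventually (\<lambda>n. s \<le> \<tau> n) sequentially"
    using assms(1) by (simp add: filterlim_at_top)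
  then have "eventually (\<lambda>n. flow f X (\<tau> n) x0 \<in> closure ((\<lambda>t. flow f X t x0) ` {s..})) sequentially"
    by eventually_elim (auto intro!: closure_subset[THEN subsetD])
  then show "p \<in> closure ((\<lambda>t. flow f X t x0) ` {s..})"
    by (rule Lim_in_closed_set[OF closed_closure _ _ assms(2)]) simp
qed

text \<open>Bolzano-Weierstrass along the sampled orbit; passing to a subsequence keeps the times
  tending to infinity.\<close>

lemma bounded_solution_limit_point:
  assumes "bounded_solution f X x0" and "filterlim \<tau> at_top sequentially" "\<And>n::nat. 0 \<le> \<tau> n"
  obtains p r where "strict_mono r" "(\<lambda>n. flow f X (\<tau> (r n)) x0) \<longlonglongrightarrow> p" "p \<in> omega_limit f X x0"
proof -
  have "bounded (range (\<lambda>n. flow f X (\<tau> n) x0))"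
    using assms(1,3) by (auto simp: bounded_solution_def flow_image_def intro: bounded_subset)
  then obtain p r where r: "strict_mono r" and "((\<lambda>n. flow f X (\<tau> n) x0) \<circ> r) \<longlonglongrightarrow> p"
    using bounded_imp_convergent_subsequence by blast
  then have p: "(\<lambda>n. flow f X (\<tau> (r n)) x0) \<longlonglongrightarrow> p" by (simp add: o_def)
  have "filterlim (\<lambda>n. \<tau> (r n)) at_top sequentially"
    using filterlim_compose[OF assms(2) filterlim_subseq[OF r]] .
  then show thesis using that r p omega_limitI by blast
qed

lemma compact_omega_limit:
  assumes "bounded_solution f X x0"
  shows "compact (omega_limit f X x0)"
proof -
  have "bounded (closure ((\<lambda>t. flow f X t x0) ` {0..}))"
    using assms by (intro bounded_closure)
      (auto simp: bounded_solution_def flow_image_def intro: bounded_subset)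
  then have "bounded (omega_limit f X x0)"
    by (rule bounded_subset) (auto simp: omega_limit_def)
  moreover have "closed (omega_limit f X x0)" by (auto simp: omega_limit_def)
  ultimately show ?thesis by (simp add: compact_eq_bounded_closed)
qed

text \<open>By continuity of \<open>infdist\<close>, a limit point has distance 0 from
  \<open>S\<close>. Nonemptiness matters because \<open>infdist\<close> to the empty set is 0 by
  convention.\<close>

lemma omega_limit_subset:
  assumes "tends_to_set f X x0 S" "closed S" "S \<noteq> {}"
  shows "omega_limit f X x0 \<subseteq> S"
proof
  fix p assume "p \<in> omega_limit f X x0"
  then obtain \<tau> where \<tau>: "\<And>n::nat. 0 + real n \<le> \<tau> n" "(\<lambda>n. flow f X (\<tau> n) x0) \<longlonglongrightarrow> p"
    using omega_limitE[where a = 0] by metis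
  have "filterlim \<tau> at_top sequentially"
    by (rule filterlim_at_top_mono[OF filterlim_real_sequentially]) (use \<tau>(1) in simp)
  then have "(\<lambda>n. infdist (flow f X (\<tau> n) x0) S) \<longlonglongrightarrow> 0"
    using assms(1) unfolding tends_to_set_def by (auto intro: filterlim_compose)
  moreover have "(\<lambda>n. infdist (flow f X (\<tau> n) x0) S) \<longlonglongrightarrow> infdist p S"
    by (rule tendsto_infdist[OF \<tau>(2)])
  ultimately have "infdist p S = 0" by (rule LIMSEQ_unique[symmetric])
  then show "p \<in> S" using assms(2,3) by (simp add: in_closed_iff_infdist_zero)
qed

text \<open>Otherwise the distance is at least some \<open>e > 0\<close> at arbitrarily late times,
  and boundedness yields an omega-limit point still at distance at least \<open>e\<close>. This
  turns an inclusion of the omega-limit set into attraction.\<close>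

lemma tends_to_set_if_omega_limit_subset:
  assumes "bounded_solution f X x0" "omega_limit f X x0 \<subseteq> S"
  shows "tends_to_set f X x0 S"
  unfolding tends_to_set_def
proof
  show "forward_complete f X x0" using assms(1) by (simp add: bounded_solution_def)
  show "((\<lambda>t. infdist (flow f X t x0) S) \<longlongrightarrow> 0) at_top"
  proof (rule ccontr)
    assume "\<not> ?thesis"
    then obtain e where "e > 0"
      and "\<not> eventually (\<lambda>t. dist (infdist (flow f X t x0) S) 0 < e) at_top"
      by (auto simp: tendsto_iff)
    then have "\<exists>t. real n \<le> t \<and> e \<le> infdist (flow f X t x0) S" for n :: nat
      by (auto simp: eventually_at_top_linorder infdist_nonneg not_less)
    then obtain \<tau> where \<tau>: "\<And>n::nat. real n \<le> \<tau> n" "\<And>n. e \<le> infdist (flow f X (\<tau> n) x0) S"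
      by metis
    have "filterlim \<tau> at_top sequentially"
      by (rule filterlim_at_top_mono[OF filterlim_real_sequentially]) (use \<tau>(1) in simp)
    moreover have "\<And>n. 0 \<le> \<tau> n" using \<tau>(1) of_nat_0_le_iff order_trans by blast
    ultimately obtain p r where lim: "(\<lambda>n. flow f X (\<tau> (r n)) x0) \<longlonglongrightarrow> p" and "p \<in> omega_limit f X x0"
      using bounded_solution_limit_point[OF assms(1)] by metis
    then have "infdist p S = 0" using assms(2) by auto
    moreover have "e \<le> infdist p S"
      by (rule tendsto_lowerbound[OF tendsto_infdist[OF lim]]) (use \<tau>(2) in auto)
    ultimately show False using \<open>e > 0\<close> by simp
  qed
qed

text \<open>If the orbit at times \<open>\<tau> n\<close> tends to \<open>p\<close>, then any limit
  point of the orbit at times \<open>\<tau> n - T\<close> is carried to \<open>p\<close> by the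
  time-\<open>T\<close> map.\<close>

lemma omega_limit_backward:
  fixes f :: "'a::euclidean_space \<Rightarrow> 'a"
  assumes lip: "local_lipschitz UNIV X (\<lambda>_::real. f)"
    and x0: "bounded_solution f X x0"
    and complete: "\<And>q. q \<in> omega_limit f X x0 \<Longrightarrow> forward_complete f X q"
    and p: "p \<in> omega_limit f X x0" and "0 \<le> T"
  obtains q where "q \<in> omega_limit f X x0" "flow f X T q = p"
proof -
  obtain \<tau> where \<tau>: "\<And>n::nat. T + real n \<le> \<tau> n" "(\<lambda>n. flow f X (\<tau> n) x0) \<longlonglongrightarrow> p"
    using omega_limitE[OF p] by metis
  have \<tau>': "real n \<le> \<tau> n - T" "0 \<le> \<tau> n - T" for n using \<tau>(1)[of n] by auto
  have "filterlim (\<lambda>n. \<tau> n - T) at_top sequentially"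
    by (rule filterlim_at_top_mono[OF filterlim_real_sequentially]) (use \<tau>'(1) in simp)
  then obtain q r where r: "strict_mono r" and q: "(\<lambda>n. flow f X (\<tau> (r n) - T) x0) \<longlonglongrightarrow> q"
    and qL: "q \<in> omega_limit f X x0"
    by (rule bounded_solution_limit_point[OF x0 _ \<tau>'(2)])
  have fc: "forward_complete f X x0" using x0 by (simp add: bounded_solution_def)
  have "(\<lambda>n. flow f X T (flow f X (\<tau> (r n) - T) x0)) \<longlonglongrightarrow> flow f X T q"
    by (rule flow_tendsto[OF lip complete[OF qL] _ q \<open>0 \<le> T\<close>])
      (rule forward_complete_flow[OF lip fc \<tau>'(2)])
  then have "(\<lambda>n. flow f X (\<tau> (r n)) x0) \<longlonglongrightarrow> flow f X T q"
    by (simp add: flow_flow[OF lip fc \<tau>'(2) \<open>0 \<le> T\<close>])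
  moreover have "(\<lambda>n. flow f X (\<tau> (r n)) x0) \<longlonglongrightarrow> p"
    using LIMSEQ_subseq_LIMSEQ[OF \<tau>(2) r] by (simp add: o_def)
  ultimately have "flow f X T q = p" by (rule LIMSEQ_unique)
  with qL show thesis by (rule that)
qed

text \<open>The time-\<open>T\<close> map shifts the times of a sequence converging to
  \<open>q\<close> by \<open>T\<close>, and they still tend to infinity.\<close>

lemma flow_omega_limit:
  fixes f :: "'a::euclidean_space \<Rightarrow> 'a"
  assumes lip: "local_lipschitz UNIV X (\<lambda>_::real. f)"
    and x0: "forward_complete f X x0"
    and q: "q \<in> omega_limit f X x0" "forward_complete f X q" and "0 \<le> T"
  shows "flow f X T q \<in> omega_limit f X x0"
proof -
  obtain \<tau> where \<tau>: "\<And>n::nat. 0 + real n \<le> \<tau> n" "(\<lambda>n. flow f X (\<tau> n) x0) \<longlonglongrightarrow> q"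
    using omega_limitE[OF q(1)] by metis
  have \<tau>0: "0 \<le> \<tau> n" for n using \<tau>(1)[of n] by simp
  have "(\<lambda>n. flow f X T (flow f X (\<tau> n) x0)) \<longlonglongrightarrow> flow f X T q"
    by (rule flow_tendsto[OF lip q(2) forward_complete_flow[OF lip x0 \<tau>0] \<tau>(2) \<open>0 \<le> T\<close>])
  then have "(\<lambda>n. flow f X (T + \<tau> n) x0) \<longlonglongrightarrow> flow f X T q"
    by (simp add: flow_flow[OF lip x0 \<tau>0 \<open>0 \<le> T\<close>])
  moreover have "filterlim (\<lambda>n. T + \<tau> n) at_top sequentially"
    by (rule filterlim_at_top_mono[OF filterlim_real_sequentially])
      (use \<tau>(1) \<open>0 \<le> T\<close> in \<open>auto intro!: always_eventually add_increasing\<close>)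
  ultimately show ?thesis by (rule omega_limitI[rotated])
qed

section \<open>Relative stability and attraction\<close>

text \<open>Here \<open>Y\<close> and \<open>G\<close> stand for \<open>\<O>\<close> and
  \<open>\<Gamma>\<close>. The hypothesis \<open>att\<close> also supplies forward completeness on
  the omega-limit set.\<close>

lemma omega_limit_subset_of_stable:
  fixes f :: "'a::euclidean_space \<Rightarrow> 'a"
  assumes lip: "local_lipschitz UNIV X (\<lambda>_::real. f)"
    and G: "closed G" "G \<noteq> {}" and st: "stable_rel f X Y G"
    and Y: "positively_invariant f X Y" "Y \<subseteq> X"
    and x0: "bounded_solution f X x0"
    and LY: "omega_limit f X x0 \<subseteq> Y"
    and att: "\<And>q. q \<in> omega_limit f X x0 \<Longrightarrow> tends_to_set f X q G"
  shows "omega_limit f X x0 \<subseteq> G"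
proof
  let ?L = "omega_limit f X x0"
  have fc0: "forward_complete f X x0" using x0 by (simp add: bounded_solution_def)
  have fc: "forward_complete f X q" if "q \<in> ?L" for q
    using att[OF that] by (simp add: tends_to_set_def)
  have inv: "flow f X t q \<in> ?L" if "q \<in> ?L" "0 \<le> t" for q t
    using flow_omega_limit[OF lip fc0 that(1) fc[OF that(1)] that(2)] .
  fix p assume p: "p \<in> ?L"
  have "infdist p G < \<epsilon>" if "\<epsilon> > 0" for \<epsilon>
  proof -
    obtain N where N: "nbhd X G N" and stN: "flow_image f X {0..} (N \<inter> Y) \<subseteq> set_ball X \<epsilon> G"
      using st \<open>\<epsilon> > 0\<close> unfolding stable_rel_def by metis
    \<comment> \<open>Membership in the ambient open set \<open>U\<close> passes along convergent
      sequences; membership in \<open>X\<close> is recovered at the end from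
      \<open>Y \<subseteq> X\<close>.\<close>
    obtain U where U: "open U" "N = X \<inter> U" using N by (auto simp: nbhd_def openin_open)
    have "\<exists>q. q \<in> ?L \<and> flow f X (real n) q = p" for n :: nat
      using omega_limit_backward[OF lip x0 fc p, of "real n"] by (metis of_nat_0_le_iff)
    then obtain q where q: "\<And>n. q n \<in> ?L" "\<And>n. flow f X (real n) (q n) = p" by metis
    have "compact ?L" using x0 by (rule compact_omega_limit)
    then obtain l r where l: "l \<in> ?L" and r: "strict_mono r" and "(q \<circ> r) \<longlonglongrightarrow> l"
      using q(1) by (meson compact_def)
    then have lim: "(\<lambda>n. q (r n)) \<longlonglongrightarrow> l" by (simp add: o_def)
    \<comment> \<open>\<open>N\<close> need not contain a uniform neighbourhood of \<open>G\<close>, so \<open>infdist\<close> tending to 0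
      does not suffice to enter \<open>N\<close>; a limit point in \<open>G\<close> does.\<close>
    have "flow_image f X {0..} {l} \<subseteq> ?L" using inv[OF l] by (auto simp: flow_image_def)
    then have bl: "bounded_solution f X l" unfolding bounded_solution_def
      using fc[OF l] \<open>compact ?L\<close> bounded_subset compact_imp_bounded by blast
    obtain g k where k: "(\<lambda>n. flow f X (real (k n)) l) \<longlonglongrightarrow> g" and g: "g \<in> omega_limit f X l"
      by (rule bounded_solution_limit_point[OF bl filterlim_real_sequentially of_nat_0_le_iff])
    have "g \<in> U" using g omega_limit_subset[OF att[OF l] G] N U(2) by (auto simp: nbhd_def)
    then have "eventually (\<lambda>n. flow f X (real (k n)) l \<in> U) sequentially"
      using k U(1) by (simp add: tendsto_def)
    then obtain n where "flow f X (real (k n)) l \<in> U"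
      using eventually_happens by force
    then obtain T where T: "0 \<le> T" "flow f X T l \<in> U" by (metis of_nat_0_le_iff)
    have "(\<lambda>n. flow f X T (q (r n))) \<longlonglongrightarrow> flow f X T l"
      by (rule flow_tendsto[OF lip fc[OF l] fc[OF q(1)] lim T(1)])
    then have "eventually (\<lambda>n. flow f X T (q (r n)) \<in> U) sequentially"
      using T(2) U(1) by (simp add: tendsto_def)
    moreover have "eventually (\<lambda>n. T \<le> real n) sequentially"
      using filterlim_real_sequentially by (simp add: filterlim_at_top)
    ultimately have "eventually (\<lambda>n. flow f X T (q (r n)) \<in> U \<and> T \<le> real n) sequentially"
      by (rule eventually_conj)
    then obtain n where n: "flow f X T (q (r n)) \<in> U" "T \<le> real n"
      using eventually_happens by force
    define y where "y = flow f X T (q (r n))"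
    \<comment> \<open>Since \<open>n \<le> r n\<close>, the time remaining after \<open>T\<close> is
      nonnegative.\<close>
    have Tr: "T \<le> real (r n)" using n(2) seq_suble[OF r, of n] by simp
    \<comment> \<open>Invariance of the omega-limit set keeps \<open>y\<close> in it, hence in
      \<open>Y\<close>, the set to which stability is relative.\<close>
    have "y \<in> Y" using inv[OF q(1) T(1)] LY by (auto simp: y_def)
    then have "y \<in> N \<inter> Y" using n(1) Y(2) U(2) by (auto simp: y_def)
    moreover have "flow f X (real (r n) - T) y = p"
      using flow_flow[OF lip fc[OF q(1)] T(1), of "real (r n) - T" "r n"] Tr q(2)
      by (simp add: y_def)
    ultimately have "p \<in> flow_image f X {0..} (N \<inter> Y)"
      using Tr unfolding flow_image_def by force
    then show ?thesis using stN by (auto simp: set_ball_def)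
  qed
  then have "infdist p G = 0" by (meson infdist_nonneg less_irrefl not_less order_antisym)
  then show "p \<in> G" using G by (simp add: in_closed_iff_infdist_zero)
qed

text \<open>Common core of (A) and (B): \<open>att\<close> follows from the closure condition in (A)
  and from global relative attraction in (B).\<close>

lemma tends_to_stable_subset:
  fixes f :: "'a::euclidean_space \<Rightarrow> 'a"
  assumes lip: "local_lipschitz UNIV X (\<lambda>_::real. f)"
    and G: "closed G" "G \<noteq> {}" "stable_rel f X Y G"
    and Y: "positively_invariant f X Y" "Y \<subseteq> X" "closed Y" "Y \<noteq> {}"
    and x0: "bounded_solution f X x0" "tends_to_set f X x0 Y"
    and att: "\<And>q. q \<in> closure (flow_image f X {0..} {x0}) \<inter> Y \<Longrightarrow> tends_to_set f X q G"
  shows "tends_to_set f X x0 G"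
proof (rule tends_to_set_if_omega_limit_subset[OF x0(1)])
  have LY: "omega_limit f X x0 \<subseteq> Y" by (rule omega_limit_subset[OF x0(2) Y(3,4)])
  have "(\<lambda>t. flow f X t x0) ` {0..} = flow_image f X {0..} {x0}"
    by (auto simp: flow_image_def)
  then have "omega_limit f X x0 \<subseteq> closure (flow_image f X {0..} {x0})"
    by (auto simp: omega_limit_def)
  then show "omega_limit f X x0 \<subseteq> G"
    using LY att by (intro omega_limit_subset_of_stable[OF lip G Y(1,2) x0(1) LY]) auto
qed

theorem theorem3p1:
  fixes \<X> \<O> \<Gamma> :: "(real ^ 'n) set"
    and f :: "real ^ 'n \<Rightarrow> real ^ 'n"
  assumes "open \<X> \<or> (smooth_submanifold \<X> \<and> (\<forall>x\<in>\<X>. f x \<in> tangent_space \<X> x))"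
    and "local_lipschitz UNIV \<X> (\<lambda>_::real. f)"
    and "\<Gamma> \<noteq> {}" and "\<Gamma> \<subseteq> \<O>" and "\<O> \<subseteq> \<X>"
    and "closed \<Gamma>" and "closed \<O>"
    and "positively_invariant f \<X> \<Gamma>" and "positively_invariant f \<X> \<O>"
  shows
    "(asymptotically_stable_rel f \<X> \<O> \<Gamma> \<and>
      locally_attractive_near f \<X> \<O> \<Gamma> \<and>
      (\<exists>N. nbhd \<X> \<Gamma> N \<and> (\<forall>x0\<in>N. bounded_solution f \<X> x0) \<and>
         closure (flow_image f \<X> {0..} N) \<inter> \<O> \<subseteq> domain_of_attraction_rel f \<X> \<O> \<Gamma>)
      \<longrightarrow> attractor f \<X> \<Gamma>) \<and>
     (globally_asymptotically_stable_rel f \<X> \<O> \<Gamma> \<and>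
      global_attractor f \<X> \<O> \<and>
      (\<forall>x0\<in>\<X>. bounded_solution f \<X> x0)
      \<longrightarrow> global_attractor f \<X> \<Gamma>)"
proof (intro conjI impI; elim conjE)
  have "\<O> \<noteq> {}" using assms(3,4) by blast
  \<comment> \<open>The open slot is relative stability, which the two parts extract from different
    hypotheses.\<close>
  note main = tends_to_stable_subset[OF assms(2,6,3) _ assms(9,5,7) this]
  {
    assume st: "asymptotically_stable_rel f \<X> \<O> \<Gamma>" and loc: "locally_attractive_near f \<X> \<O> \<Gamma>"
      and "\<exists>N. nbhd \<X> \<Gamma> N \<and> (\<forall>x0\<in>N. bounded_solution f \<X> x0) \<and>
         closure (flow_image f \<X> {0..} N) \<inter> \<O> \<subseteq> domain_of_attraction_rel f \<X> \<O> \<Gamma>"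
    then obtain N where N: "nbhd \<X> \<Gamma> N" and bd: "\<forall>x0\<in>N. bounded_solution f \<X> x0"
      and cl: "closure (flow_image f \<X> {0..} N) \<inter> \<O> \<subseteq> domain_of_attraction_rel f \<X> \<O> \<Gamma>"
      by blast
    obtain M where M: "nbhd \<X> \<Gamma> M" "\<forall>x0\<in>M. tends_to_set f \<X> x0 \<O>"
      using loc unfolding locally_attractive_near_def by blast
    \<comment> \<open>\<open>M\<close> provides attraction to \<open>\<O>\<close>, and
      \<open>N\<close> provides boundedness and the closure condition.\<close>
    have "tends_to_set f \<X> x0 \<Gamma>" if x0: "x0 \<in> M \<inter> N" for x0
    proof (rule main)
      show "stable_rel f \<X> \<O> \<Gamma>" using st by (simp add: asymptotically_stable_rel_def)
      show "bounded_solution f \<X> x0" "tends_to_set f \<X> x0 \<O>" using x0 bd M(2) by blast+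
      have "flow_image f \<X> {0..} {x0} \<subseteq> flow_image f \<X> {0..} N"
        using x0 by (auto simp: flow_image_def)
      then have "closure (flow_image f \<X> {0..} {x0}) \<subseteq> closure (flow_image f \<X> {0..} N)"
        by (rule closure_mono)
      then show "tends_to_set f \<X> q \<Gamma>" if "q \<in> closure (flow_image f \<X> {0..} {x0}) \<inter> \<O>" for q
        using cl that by (auto simp: domain_of_attraction_rel_def)
    qed
    moreover have "nbhd \<X> \<Gamma> (M \<inter> N)" using M(1) N by (auto simp: nbhd_def)
    ultimately show "attractor f \<X> \<Gamma>" unfolding attractor_def by blast
  }
  {
    assume st: "globally_asymptotically_stable_rel f \<X> \<O> \<Gamma>" and glob: "global_attractor f \<X> \<O>"
      and bd: "\<forall>x0\<in>\<X>. bounded_solution f \<X> x0"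
    show "global_attractor f \<X> \<Gamma>"
      unfolding global_attractor_def
    proof
      fix x0 assume "x0 \<in> \<X>"
      then have "bounded_solution f \<X> x0" "tends_to_set f \<X> x0 \<O>"
        using bd glob by (auto simp: global_attractor_def)
      then show "tends_to_set f \<X> x0 \<Gamma>"
        \<comment> \<open>Global attraction relative to \<open>\<O>\<close> covers every point of
          the orbit closure that lies in \<open>\<O>\<close>.\<close>
        using st by (intro main[of x0])
          (auto simp: globally_asymptotically_stable_rel_def global_attractor_rel_def)
    qed
  }
qed

end
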